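(* Let $L$ be any of the fifteen logics of the modal cube. For every set of formulas $\Gamma$ and formula $\alpha$, if $\Gamma\vDash^L\alpha$ (partial-semantic consequence) then $\Gamma\vdash_L\alpha$.
   Context: Syntax and logics. Formulas: $\alpha ::= p \mid \bot \mid \alpha\to\alpha \mid \Box\alpha$; $\mathrm{For}$ is the set of formulas; $\neg\alpha:=\alpha\to\bot$, $\Diamond\alpha:=\neg\Box\neg\alpha$, $\wedge,\vee$ the usual classical abbreviations. $\mathbf K$: classical propositional axioms, (k) $\Box(\alpha\to\beta)\to(\Box\alpha\to\Box\beta)$, modus ponens, necessitation. Axiom schemes (D) $\Box\alpha\to\Diamond\alpha$, (T) $\Box\alpha\to\alpha$, (B) $\alpha\to\Box\Diamond\alpha$, (4) $\Box\alpha\to\Box\Box\alpha$, (5) $\Diamond\alpha\to\Box\Diamond\alpha$. The modal cube: $\mathbf K,\mathbf{KB},\mathbf{K4},\mathbf{K5},\mathbf{K45},\mathbf{KD},\mathbf{KDB},\mathbf{KD4},\mathbf{KD5},\mathbf{KD45},\mathbf{KT},\mathbf{KTB},\mathbf{S4}=\mathbf{KT4},\mathbf{S5}=\mathbf{KTB45},\mathbf{KB5}=\mathbf{KB45}$. $\Gamma\vdash_L\alpha$ means $\alpha$ or $(\gamma_1\wedge\dots\wedge\gamma_k)\to\alpha$ (some $\gamma_i\in\Gamma$) is a theorem of $L$. Truth values $\mathbf{F},\mathbf{f},\mathbf{f}_2,\mathbf{f}_3,\mathbf{t}_3,\mathbf{t}_2,\mathbf{t},\mathbf{T}$. Distinguished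 sets: $\mathcal D=\{\mathbf T,\mathbf t,\mathbf t_2,\mathbf t_3\}$ (designated), $N=\{\mathbf T,\mathbf t_2,\mathbf f_3,\mathbf f_2\}$, $I=\{\mathbf F,\mathbf f_2,\mathbf t_3,\mathbf t_2\}$, $P=\{\mathbf T,\mathbf t,\mathbf f_3,\mathbf f\}$, $PN=\{\mathbf F,\mathbf f,\mathbf t_3,\mathbf t\}$. Nmatrix $\mathcal M_L$. Values $V(L)$: all eight values for $\mathbf K,\mathbf{KB},\mathbf{K4},\mathbf{K5},\mathbf{K45}$; $\{\mathbf F,\mathbf f,\mathbf f_2,\mathbf t_2,\mathbf t,\mathbf T\}$ for $\mathbf{KB5}$; $\{\mathbf F,\mathbf f,\mathbf f_3,\mathbf t_3,\mathbf t,\mathbf T\}$ for $\mathbf{KD},\mathbf{KDB},\mathbf{KD4},\mathbf{KD5},\mathbf{KD45}$; $\{\mathbf F,\mathbf f,\mathbf t,\mathbf T\}$ for $\mathbf{KT},\mathbf{KTB},\mathbf{S4},\mathbf{S5}$. $\tilde\bot=\{\mathbf F,\mathbf f_2\}$. $\tilde\to(x,y)$, restricted to arguments in $V(L)$, listed for $y=\mathbf F,\mathbf f,\mathbf f_2,\mathbf f_3,\mathbf t_3,\mathbf t_2,\mathbf t,\mathbf T$: $x=\mathbf F$: $\{\mathbf T\}$ for all $y$; $x=\mathbf f$: $\{\mathbf t\},\{\mathbf T,\mathbf t\},\{\mathbf t_2\},\{\mathbf T\},\{\mathbf t\},\{\mathbf T\},\{\mathbf T,\mathbf t\},\{\mathbf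 T\}$; $x=\mathbf f_2$ and $x=\mathbf f_3$: $\{\mathbf t_3\},\{\mathbf t\},\{\mathbf t_2\},\{\mathbf T\},\{\mathbf t_3\},\{\mathbf t_2\},\{\mathbf t\},\{\mathbf T\}$; $x=\mathbf t_3$: $\{\mathbf f_3\}$ for $y\in\{\mathbf F,\mathbf f,\mathbf f_2,\mathbf f_3\}$, $\{\mathbf T\}$ otherwise; $x=\mathbf t_2$: $\{\mathbf F\},\{\mathbf f\},\{\mathbf f_2\},\{\mathbf f_3\},\{\mathbf t_3\},\{\mathbf t_2\},\{\mathbf t_3\},\{\mathbf T\}$; $x=\mathbf t$: $\{\mathbf f\},\{\mathbf f,\mathbf f_3\},\{\mathbf f_3\},\{\mathbf f_3\},\{\mathbf t\},\{\mathbf T\},\{\mathbf T,\mathbf t\},\{\mathbf T\}$; $x=\mathbf T$: $\{\mathbf F\},\{\mathbf f\},\{\mathbf f_2\},\{\mathbf f_3\},\{\mathbf t_3\},\{\mathbf t_2\},\{\mathbf t\},\{\mathbf T\}$. $\tilde\Box$ (argument $\mapsto$ output): $\mathbf K$: $\mathbf F,\mathbf f,\mathbf t_3,\mathbf t\mapsto\{\mathbf F,\mathbf f,\mathbf f_3\}$; $\mathbf f_2,\mathbf t_2\mapsto\{\mathbf t_2\}$; $\mathbf f_3,\mathbf T\mapsto\{\mathbf T,\mathbf t,\mathbf t_3\}$. $\mathbf{KB}$: $\mathbf F,\mathbf f\mapsto\{\mathbf F\}$; $\mathbf f_2,\mathbf t_2\mapsto\{\mathbf t_2\}$; $\mathbf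 f_3\mapsto\{\mathbf t_3\}$; $\mathbf t_3,\mathbf t\mapsto\{\mathbf F,\mathbf f,\mathbf f_3\}$; $\mathbf T\mapsto\{\mathbf T,\mathbf t,\mathbf t_3\}$. $\mathbf{K4}$: $\mathbf F,\mathbf f,\mathbf t_3,\mathbf t\mapsto\{\mathbf F,\mathbf f,\mathbf f_3\}$; $\mathbf f_2,\mathbf t_2\mapsto\{\mathbf t_2\}$; $\mathbf f_3,\mathbf T\mapsto\{\mathbf T\}$. $\mathbf{K5}$: $\mathbf F,\mathbf f,\mathbf t_3,\mathbf t\mapsto\{\mathbf F\}$; $\mathbf f_2,\mathbf t_2\mapsto\{\mathbf t_2\}$; $\mathbf f_3,\mathbf T\mapsto\{\mathbf T,\mathbf t_3\}$. $\mathbf{K45}$: $\mathbf F,\mathbf f,\mathbf t_3,\mathbf t\mapsto\{\mathbf F\}$; $\mathbf f_2,\mathbf t_2\mapsto\{\mathbf t_2\}$; $\mathbf f_3,\mathbf T\mapsto\{\mathbf T\}$. $\mathbf{KB5}$: $\mathbf F,\mathbf f,\mathbf t\mapsto\{\mathbf F\}$; $\mathbf f_2,\mathbf t_2\mapsto\{\mathbf t_2\}$; $\mathbf T\mapsto\{\mathbf T\}$. $\mathbf{KD}$: $\mathbf F,\mathbf f,\mathbf t_3,\mathbf t\mapsto\{\mathbf F,\mathbf f,\mathbf f_3\}$; $\mathbf f_3,\mathbf T\mapsto\{\mathbf T,\mathbf t,\mathbf t_3\}$. $\mathbf{KDB}$: $\mathbf F,\mathbf f\mapsto\{\mathbf F\}$;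 $\mathbf f_3\mapsto\{\mathbf t_3\}$; $\mathbf t_3,\mathbf t\mapsto\{\mathbf F,\mathbf f,\mathbf f_3\}$; $\mathbf T\mapsto\{\mathbf T,\mathbf t,\mathbf t_3\}$. $\mathbf{KD4}$: $\mathbf F,\mathbf t_3\mapsto\{\mathbf F\}$; $\mathbf f,\mathbf t\mapsto\{\mathbf F,\mathbf f,\mathbf f_3\}$; $\mathbf f_3,\mathbf T\mapsto\{\mathbf T\}$. $\mathbf{KD5}$: $\mathbf F,\mathbf f,\mathbf t_3,\mathbf t\mapsto\{\mathbf F\}$; $\mathbf f_3,\mathbf T\mapsto\{\mathbf T,\mathbf t_3\}$. $\mathbf{KD45}$: $\mathbf F,\mathbf f,\mathbf t_3,\mathbf t\mapsto\{\mathbf F\}$; $\mathbf f_3,\mathbf T\mapsto\{\mathbf T\}$. $\mathbf{KT}$: $\mathbf F\mapsto\{\mathbf F\}$; $\mathbf f,\mathbf t\mapsto\{\mathbf F,\mathbf f\}$; $\mathbf T\mapsto\{\mathbf T,\mathbf t\}$. $\mathbf{KTB}$: $\mathbf F,\mathbf f\mapsto\{\mathbf F\}$; $\mathbf t\mapsto\{\mathbf F,\mathbf f\}$; $\mathbf T\mapsto\{\mathbf T,\mathbf t\}$. $\mathbf{S4}$: $\mathbf F\mapsto\{\mathbf F\}$; $\mathbf f,\mathbf t\mapsto\{\mathbf F,\mathbf f\}$; $\mathbf T\mapsto\{\mathbf T\}$. $\mathbf{S5}$: $\mathbf F,\mathbf f,\mathbf t\mapsto\{\mathbf F\}$; $\mathbf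 T\mapsto\{\mathbf T\}$. Partial valuations: for $\Lambda$ closed under subformulas, $[\Lambda\to V]_{\mathcal M_L}$ is the set of maps $v:\Lambda\to V(L)$ with $v(\bot)\in\tilde\bot$, $v(\beta\to\gamma)\in\tilde\to(v(\beta),v(\gamma))$, $v(\Box\beta)\in\tilde\Box(v(\beta))$ whenever these formulas lie in $\Lambda$. Models: a pre-model on $\Lambda$ is a pair $\langle\Pi,R\rangle$ with $\Pi\subseteq[\Lambda\to V]_{\mathcal M_L}$ and $R\subseteq\Pi\times\Pi$ such that for all $v\in\Pi$, $\beta\in\Lambda$: if $v(\beta)\in P$ there is $w\in\Pi$ with $vRw$ and $w(\beta)\in\mathcal D$; if $v(\beta)\in PN$ there is $w\in\Pi$ with $vRw$ and $w(\beta)\notin\mathcal D$. A $\mathbf K$-model is a pre-model such that whenever $vRw$: $v(\beta)\in N\Rightarrow w(\beta)\in\mathcal D$ and $v(\beta)\in I\Rightarrow w(\beta)\notin\mathcal D$. An $L$-model is a $\mathbf K$-model satisfying, for each axiom scheme among (T),(D),(B),(4),(5) that holds in $L$, the following conditions for all $v,w,w'\in\Pi$, $\beta\in\Lambda$: (T): $v(\beta)\in N\Rightarrow v(\beta)\in\mathcal D$, and $v(\beta)\in I\Rightarrow v(\beta)\notin\mathcal D$; (D): $v(\beta)\in N\Rightarrow v(\beta)\in P$, and $v(\beta)\in I\Rightarrow v(\beta)\in PN$; (B): if $vRw$, then $v(\beta)\in\mathcal D\Rightarrow w(\beta)\in P$ and $v(\beta)\notin\mathcal D\Rightarrow w(\beta)\in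 PN$; (4): if $vRw$, then $v(\beta)\in N\Rightarrow w(\beta)\in N$ and $v(\beta)\in I\Rightarrow w(\beta)\in I$; (5): if $vRw$, then $v(\beta)\in P\Rightarrow w(\beta)\in P$ and $v(\beta)\in PN\Rightarrow w(\beta)\in PN$; moreover if $v(\beta),w(\beta)\in N$, $vRw$ and ($vRw'$ or $wRw'$) then $w'(\beta)\in N$, and likewise with $I$ in place of $N$. A partial valuation $v$ is a partial level-valuation (for $L$) if $v\in\Pi$ for some $L$-model $\langle\Pi,R\rangle$. Partial-semantic consequence: writing $\overline{\Gamma\cup\{\alpha\}}$ for the smallest set containing $\Gamma\cup\{\alpha\}$ closed under subformulas, $\Gamma\vDash^L\alpha$ holds iff for every partial level-valuation $v$ with domain $\overline{\Gamma\cup\{\alpha\}}$: if $v(\beta)\in\mathcal D$ for all $\beta\in\Gamma$ then $v(\alpha)\in\mathcal D$. *)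

theory Defs
  imports Main "HOL.Hull" "HOL-Library.FuncSet"
begin

section \<open>Syntax\<close>

datatype 'p fm =
    Atom 'p
  | Bot  ("\<^bold>\<bottom>")
  | Imp "'p fm" "'p fm"  (infixr "\<^bold>\<rightarrow>" 55)
  | Box "'p fm"  ("\<^bold>\<box> _" [70] 70)

abbreviation Neg :: "'p fm \<Rightarrow> 'p fm"  ("\<^bold>\<not> _" [70] 70)
  where "\<^bold>\<not> \<alpha> \<equiv> \<alpha> \<^bold>\<rightarrow> \<^bold>\<bottom>"

abbreviation Dia :: "'p fm \<Rightarrow> 'p fm"  ("\<^bold>\<diamond> _" [70] 70)
  where "\<^bold>\<diamond> \<alpha> \<equiv> \<^bold>\<not> \<^bold>\<box> \<^bold>\<not> \<alpha>"

abbreviation Con :: "'p fm \<Rightarrow> 'p fm \<Rightarrow> 'p fm"  (infixl "\<^bold>\<and>" 60)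
  where "\<alpha> \<^bold>\<and> \<beta> \<equiv> \<^bold>\<not> (\<alpha> \<^bold>\<rightarrow> \<^bold>\<not> \<beta>)"

primrec subformulas :: "'p fm \<Rightarrow> 'p fm set" where
  "subformulas (Atom p) = {Atom p}"
| "subformulas \<^bold>\<bottom> = {\<^bold>\<bottom>}"
| "subformulas (\<alpha> \<^bold>\<rightarrow> \<beta>) = insert (\<alpha> \<^bold>\<rightarrow> \<beta>) (subformulas \<alpha> \<union> subformulas \<beta>)"
| "subformulas (\<^bold>\<box> \<alpha>) = insert (\<^bold>\<box> \<alpha>) (subformulas \<alpha>)"

definition subformula_closed :: "'p fm set \<Rightarrow> bool" where
  "subformula_closed \<Lambda> \<longleftrightarrow> (\<forall>\<alpha>\<in>\<Lambda>. subformulas \<alpha> \<subseteq> \<Lambda>)"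

definition subformula_closure :: "'p fm set \<Rightarrow> 'p fm set" where
  "subformula_closure S = subformula_closed hull S"


section \<open>The logics of the modal cube\<close>

datatype scheme = Ax_D | Ax_T | Ax_B | Ax_4 | Ax_5

primrec scheme_inst :: "scheme \<Rightarrow> 'p fm \<Rightarrow> 'p fm" where
  "scheme_inst Ax_D \<alpha> = (\<^bold>\<box> \<alpha> \<^bold>\<rightarrow> \<^bold>\<diamond> \<alpha>)"
| "scheme_inst Ax_T \<alpha> = (\<^bold>\<box> \<alpha> \<^bold>\<rightarrow> \<alpha>)"
| "scheme_inst Ax_B \<alpha> = (\<alpha> \<^bold>\<rightarrow> \<^bold>\<box> \<^bold>\<diamond> \<alpha>)"
| "scheme_inst Ax_4 \<alpha> = (\<^bold>\<box> \<alpha> \<^bold>\<rightarrow> \<^bold>\<box> \<^bold>\<box> \<alpha>)"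
| "scheme_inst Ax_5 \<alpha> = (\<^bold>\<diamond> \<alpha> \<^bold>\<rightarrow> \<^bold>\<box> \<^bold>\<diamond> \<alpha>)"

datatype cube =
    K | KB | K4 | K5 | K45 | KB5
  | KD | KDB | KD4 | KD5 | KD45
  | KT | KTB | S4 | S5

primrec schemes :: "cube \<Rightarrow> scheme set" where
  "schemes K = {}"
| "schemes KB = {Ax_B}"
| "schemes K4 = {Ax_4}"
| "schemes K5 = {Ax_5}"
| "schemes K45 = {Ax_4, Ax_5}"
| "schemes KB5 = {Ax_B, Ax_4, Ax_5}"
| "schemes KD = {Ax_D}"
| "schemes KDB = {Ax_D, Ax_B}"
| "schemes KD4 = {Ax_D, Ax_4}"
| "schemes KD5 = {Ax_D, Ax_5}"
| "schemes KD45 = {Ax_D, Ax_4, Ax_5}"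
| "schemes KT = {Ax_T}"
| "schemes KTB = {Ax_T, Ax_B}"
| "schemes S4 = {Ax_T, Ax_4}"
| "schemes S5 = {Ax_T, Ax_B, Ax_4, Ax_5}"

text \<open>The first three schemes axiomatise classical propositional logic over
  implication and falsum.\<close>

inductive_set thms :: "cube \<Rightarrow> 'p fm set" for L :: cube where
  P1: "\<alpha> \<^bold>\<rightarrow> \<beta> \<^bold>\<rightarrow> \<alpha> \<in> thms L"
| P2: "(\<alpha> \<^bold>\<rightarrow> \<beta> \<^bold>\<rightarrow> \<gamma>) \<^bold>\<rightarrow> (\<alpha> \<^bold>\<rightarrow> \<beta>) \<^bold>\<rightarrow> \<alpha> \<^bold>\<rightarrow> \<gamma> \<in> thms L"
| P3: "\<^bold>\<not> \<^bold>\<not> \<alpha> \<^bold>\<rightarrow> \<alpha> \<in> thms L"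
| k: "\<^bold>\<box> (\<alpha> \<^bold>\<rightarrow> \<beta>) \<^bold>\<rightarrow> \<^bold>\<box> \<alpha> \<^bold>\<rightarrow> \<^bold>\<box> \<beta> \<in> thms L"
| scheme: "s \<in> schemes L \<Longrightarrow> scheme_inst s \<alpha> \<in> thms L"
| MP: "\<alpha> \<^bold>\<rightarrow> \<beta> \<in> thms L \<Longrightarrow> \<alpha> \<in> thms L \<Longrightarrow> \<beta> \<in> thms L"
| Nec: "\<alpha> \<in> thms L \<Longrightarrow> \<^bold>\<box> \<alpha> \<in> thms L"

text \<open>The nonempty list of premises is \<open>\<gamma> # \<gamma>s\<close>.\<close>

definition derives :: "'p fm set \<Rightarrow> cube \<Rightarrow> 'p fm \<Rightarrow> bool"  ("_ \<turnstile>\<^bsub>_\<^esub> _" [51, 0, 51] 50) where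
  "\<Gamma> \<turnstile>\<^bsub>L\<^esub> \<alpha> \<longleftrightarrow>
     \<alpha> \<in> thms L \<or>
     (\<exists>\<gamma> \<gamma>s. set (\<gamma> # \<gamma>s) \<subseteq> \<Gamma> \<and> foldl Con \<gamma> \<gamma>s \<^bold>\<rightarrow> \<alpha> \<in> thms L)"


section \<open>The Nmatrices\<close>

datatype val = VF | Vf | Vf2 | Vf3 | Vt3 | Vt2 | Vt | VT

definition Des :: "val set" where "Des = {VT, Vt, Vt2, Vt3}"
definition NN :: "val set" where "NN = {VT, Vt2, Vf3, Vf2}"
definition II :: "val set" where "II = {VF, Vf2, Vt3, Vt2}"
definition PP :: "val set" where "PP = {VT, Vt, Vf3, Vf}"
definition PN :: "val set" where "PN = {VF, Vf, Vt3, Vt}"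

definition vals :: "cube \<Rightarrow> val set" where
  "vals L =
    (if L \<in> {K, KB, K4, K5, K45} then UNIV
     else if L = KB5 then {VF, Vf, Vf2, Vt2, Vt, VT}
     else if L \<in> {KD, KDB, KD4, KD5, KD45} then {VF, Vf, Vf3, Vt3, Vt, VT}
     else {VF, Vf, Vt, VT})"

definition bot_tab :: "val set" where "bot_tab = {VF, Vf2}"

text \<open>In the tables below, neither the arguments nor the outputs are cut down to \<open>vals L\<close>:
  valuations take their values in \<open>vals L\<close>, so the remaining entries never matter.\<close>

primrec imp_tab :: "val \<Rightarrow> val \<Rightarrow> val set" where
  "imp_tab VF y = {VT}"
| "imp_tab Vf y = (case y of
     VF \<Rightarrow> {Vt} | Vf \<Rightarrow> {VT, Vt} | Vf2 \<Rightarrow> {Vt2} | Vf3 \<Rightarrow> {VT}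
   | Vt3 \<Rightarrow> {Vt} | Vt2 \<Rightarrow> {VT} | Vt \<Rightarrow> {VT, Vt} | VT \<Rightarrow> {VT})"
| "imp_tab Vf2 y = (case y of
     VF \<Rightarrow> {Vt3} | Vf \<Rightarrow> {Vt} | Vf2 \<Rightarrow> {Vt2} | Vf3 \<Rightarrow> {VT}
   | Vt3 \<Rightarrow> {Vt3} | Vt2 \<Rightarrow> {Vt2} | Vt \<Rightarrow> {Vt} | VT \<Rightarrow> {VT})"
| "imp_tab Vf3 y = (case y of
     VF \<Rightarrow> {Vt3} | Vf \<Rightarrow> {Vt} | Vf2 \<Rightarrow> {Vt2} | Vf3 \<Rightarrow> {VT}
   | Vt3 \<Rightarrow> {Vt3} | Vt2 \<Rightarrow> {Vt2} | Vt \<Rightarrow> {Vt} | VT \<Rightarrow> {VT})"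
| "imp_tab Vt3 y = (if y \<in> {VF, Vf, Vf2, Vf3} then {Vf3} else {VT})"
| "imp_tab Vt2 y = (case y of
     VF \<Rightarrow> {VF} | Vf \<Rightarrow> {Vf} | Vf2 \<Rightarrow> {Vf2} | Vf3 \<Rightarrow> {Vf3}
   | Vt3 \<Rightarrow> {Vt3} | Vt2 \<Rightarrow> {Vt2} | Vt \<Rightarrow> {Vt3} | VT \<Rightarrow> {VT})"
| "imp_tab Vt y = (case y of
     VF \<Rightarrow> {Vf} | Vf \<Rightarrow> {Vf, Vf3} | Vf2 \<Rightarrow> {Vf3} | Vf3 \<Rightarrow> {Vf3}
   | Vt3 \<Rightarrow> {Vt} | Vt2 \<Rightarrow> {VT} | Vt \<Rightarrow> {VT, Vt} | VT \<Rightarrow> {VT})"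
| "imp_tab VT y = {y}"

primrec box_tab :: "cube \<Rightarrow> val \<Rightarrow> val set" where
  "box_tab K x =
    (if x \<in> {VF, Vf, Vt3, Vt} then {VF, Vf, Vf3}
     else if x \<in> {Vf2, Vt2} then {Vt2}
     else {VT, Vt, Vt3})"
| "box_tab KB x =
    (if x \<in> {VF, Vf} then {VF}
     else if x \<in> {Vf2, Vt2} then {Vt2}
     else if x = Vf3 then {Vt3}
     else if x \<in> {Vt3, Vt} then {VF, Vf, Vf3}
     else {VT, Vt, Vt3})"
| "box_tab K4 x =
    (if x \<in> {VF, Vf, Vt3, Vt} then {VF, Vf, Vf3}
     else if x \<in> {Vf2, Vt2} then {Vt2}
     else {VT})"
| "box_tab K5 x =
    (if x \<in> {VF, Vf, Vt3, Vt} then {VF}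
     else if x \<in> {Vf2, Vt2} then {Vt2}
     else {VT, Vt3})"
| "box_tab K45 x =
    (if x \<in> {VF, Vf, Vt3, Vt} then {VF}
     else if x \<in> {Vf2, Vt2} then {Vt2}
     else {VT})"
| "box_tab KB5 x =
    (if x \<in> {VF, Vf, Vt} then {VF}
     else if x \<in> {Vf2, Vt2} then {Vt2}
     else if x = VT then {VT}
     else {})"
| "box_tab KD x =
    (if x \<in> {VF, Vf, Vt3, Vt} then {VF, Vf, Vf3}
     else if x \<in> {Vf3, VT} then {VT, Vt, Vt3}
     else {})"
| "box_tab KDB x =
    (if x \<in> {VF, Vf} then {VF}
     else if x = Vf3 then {Vt3}
     else if x \<in> {Vt3, Vt} then {VF, Vf, Vf3}
     else if x = VT then {VT, Vt, Vt3}
     else {})"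
| "box_tab KD4 x =
    (if x \<in> {VF, Vt3} then {VF}
     else if x \<in> {Vf, Vt} then {VF, Vf, Vf3}
     else if x \<in> {Vf3, VT} then {VT}
     else {})"
| "box_tab KD5 x =
    (if x \<in> {VF, Vf, Vt3, Vt} then {VF}
     else if x \<in> {Vf3, VT} then {VT, Vt3}
     else {})"
| "box_tab KD45 x =
    (if x \<in> {VF, Vf, Vt3, Vt} then {VF}
     else if x \<in> {Vf3, VT} then {VT}
     else {})"
| "box_tab KT x =
    (if x = VF then {VF}
     else if x \<in> {Vf, Vt} then {VF, Vf}
     else if x = VT then {VT, Vt}
     else {})"
| "box_tab KTB x =
    (if x \<in> {VF, Vf} then {VF}
     else if x = Vt then {VF, Vf}
     else if x = VT then {VT, Vt}
     else {})"
| "box_tab S4 x =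
    (if x = VF then {VF}
     else if x \<in> {Vf, Vt} then {VF, Vf}
     else if x = VT then {VT}
     else {})"
| "box_tab S5 x =
    (if x \<in> {VF, Vf, Vt} then {VF}
     else if x = VT then {VT}
     else {})"


section \<open>Partial valuations and models\<close>

text \<open>Maps with domain \<open>\<Lambda>\<close> are extensional functions, so that two of them are equal iff they agree
  on \<open>\<Lambda>\<close>. The definitions below are meant for subformula-closed \<open>\<Lambda>\<close>.\<close>

definition partial_vals :: "cube \<Rightarrow> 'p fm set \<Rightarrow> ('p fm \<Rightarrow> val) set" where
  "partial_vals L \<Lambda> =
    {v \<in> \<Lambda> \<rightarrow>\<^sub>E vals L.
       (\<^bold>\<bottom> \<in> \<Lambda> \<longrightarrow> v \<^bold>\<bottom> \<in> bot_tab) \<and>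
       (\<forall>\<beta> \<gamma>. \<beta> \<^bold>\<rightarrow> \<gamma> \<in> \<Lambda> \<longrightarrow> v (\<beta> \<^bold>\<rightarrow> \<gamma>) \<in> imp_tab (v \<beta>) (v \<gamma>)) \<and>
       (\<forall>\<beta>. \<^bold>\<box> \<beta> \<in> \<Lambda> \<longrightarrow> v (\<^bold>\<box> \<beta>) \<in> box_tab L (v \<beta>))}"

definition pre_model ::
    "cube \<Rightarrow> 'p fm set \<Rightarrow> ('p fm \<Rightarrow> val) set \<Rightarrow> ('p fm \<Rightarrow> val) rel \<Rightarrow> bool" where
  "pre_model L \<Lambda> W R \<longleftrightarrow>
     W \<subseteq> partial_vals L \<Lambda> \<and> R \<subseteq> W \<times> W \<and>
     (\<forall>v\<in>W. \<forall>\<beta>\<in>\<Lambda>.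
        (v \<beta> \<in> PP \<longrightarrow> (\<exists>w\<in>W. (v, w) \<in> R \<and> w \<beta> \<in> Des)) \<and>
        (v \<beta> \<in> PN \<longrightarrow> (\<exists>w\<in>W. (v, w) \<in> R \<and> w \<beta> \<notin> Des)))"

definition K_model ::
    "cube \<Rightarrow> 'p fm set \<Rightarrow> ('p fm \<Rightarrow> val) set \<Rightarrow> ('p fm \<Rightarrow> val) rel \<Rightarrow> bool" where
  "K_model L \<Lambda> W R \<longleftrightarrow>
     pre_model L \<Lambda> W R \<and>
     (\<forall>v w. (v, w) \<in> R \<longrightarrow> (\<forall>\<beta>\<in>\<Lambda>.
        (v \<beta> \<in> NN \<longrightarrow> w \<beta> \<in> Des) \<and> (v \<beta> \<in> II \<longrightarrow> w \<beta> \<notin> Des)))"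

primrec scheme_cond ::
    "scheme \<Rightarrow> 'p fm set \<Rightarrow> ('p fm \<Rightarrow> val) set \<Rightarrow> ('p fm \<Rightarrow> val) rel \<Rightarrow> bool" where
  "scheme_cond Ax_T \<Lambda> W R \<longleftrightarrow>
     (\<forall>v\<in>W. \<forall>\<beta>\<in>\<Lambda>. (v \<beta> \<in> NN \<longrightarrow> v \<beta> \<in> Des) \<and> (v \<beta> \<in> II \<longrightarrow> v \<beta> \<notin> Des))"
| "scheme_cond Ax_D \<Lambda> W R \<longleftrightarrow>
     (\<forall>v\<in>W. \<forall>\<beta>\<in>\<Lambda>. (v \<beta> \<in> NN \<longrightarrow> v \<beta> \<in> PP) \<and> (v \<beta> \<in> II \<longrightarrow> v \<beta> \<in> PN))"
| "scheme_cond Ax_B \<Lambda> W R \<longleftrightarrow>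
     (\<forall>v\<in>W. \<forall>w\<in>W. \<forall>\<beta>\<in>\<Lambda>. (v, w) \<in> R \<longrightarrow>
        (v \<beta> \<in> Des \<longrightarrow> w \<beta> \<in> PP) \<and> (v \<beta> \<notin> Des \<longrightarrow> w \<beta> \<in> PN))"
| "scheme_cond Ax_4 \<Lambda> W R \<longleftrightarrow>
     (\<forall>v\<in>W. \<forall>w\<in>W. \<forall>\<beta>\<in>\<Lambda>. (v, w) \<in> R \<longrightarrow>
        (v \<beta> \<in> NN \<longrightarrow> w \<beta> \<in> NN) \<and> (v \<beta> \<in> II \<longrightarrow> w \<beta> \<in> II))"
| "scheme_cond Ax_5 \<Lambda> W R \<longleftrightarrow>
     (\<forall>v\<in>W. \<forall>w\<in>W. \<forall>\<beta>\<in>\<Lambda>. (v, w) \<in> R \<longrightarrow>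
        (v \<beta> \<in> PP \<longrightarrow> w \<beta> \<in> PP) \<and> (v \<beta> \<in> PN \<longrightarrow> w \<beta> \<in> PN)) \<and>
     (\<forall>v\<in>W. \<forall>w\<in>W. \<forall>w'\<in>W. \<forall>\<beta>\<in>\<Lambda>. (v, w) \<in> R \<and> ((v, w') \<in> R \<or> (w, w') \<in> R) \<longrightarrow>
        (v \<beta> \<in> NN \<and> w \<beta> \<in> NN \<longrightarrow> w' \<beta> \<in> NN) \<and>
        (v \<beta> \<in> II \<and> w \<beta> \<in> II \<longrightarrow> w' \<beta> \<in> II))"

text \<open>A scheme holds in \<open>L\<close> if all its instances are theorems of \<open>L\<close>, whether or not it is among the
  axioms \<open>schemes L\<close> (for example, \<open>Ax_D\<close> holds in \<open>KT\<close>).\<close>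

definition L_model ::
    "cube \<Rightarrow> 'p fm set \<Rightarrow> ('p fm \<Rightarrow> val) set \<Rightarrow> ('p fm \<Rightarrow> val) rel \<Rightarrow> bool" where
  "L_model L \<Lambda> W R \<longleftrightarrow>
     K_model L \<Lambda> W R \<and>
     (\<forall>s. (\<forall>\<alpha>::'p fm. scheme_inst s \<alpha> \<in> thms L) \<longrightarrow> scheme_cond s \<Lambda> W R)"

definition partial_level_vals :: "cube \<Rightarrow> 'p fm set \<Rightarrow> ('p fm \<Rightarrow> val) set" where
  "partial_level_vals L \<Lambda> = {v. \<exists>W R. L_model L \<Lambda> W R \<and> v \<in> W}"

definition entails :: "'p fm set \<Rightarrow> cube \<Rightarrow> 'p fm \<Rightarrow> bool"  ("_ \<Turnstile>\<^bsub>_\<^esub> _" [51, 0, 51] 50) where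
  "\<Gamma> \<Turnstile>\<^bsub>L\<^esub> \<alpha> \<longleftrightarrow>
     (\<forall>v \<in> partial_level_vals L (subformula_closure (\<Gamma> \<union> {\<alpha>})).
        (\<forall>\<beta>\<in>\<Gamma>. v \<beta> \<in> Des) \<longrightarrow> v \<alpha> \<in> Des)"

end

theory Submission
  imports Defs
begin

text \<open>If \<open>\<alpha>\<close> is not derivable from \<open>\<Gamma>\<close>, the canonical Kripke model of \<open>L\<close> has a world \<open>a\<close> that
  satisfies \<open>\<Gamma>\<close> but not \<open>\<alpha>\<close>. A world \<open>w\<close> gives \<open>\<beta>\<close> the truth value that records whether \<open>\<beta>\<close>,
  \<open>\<box>\<beta>\<close> and \<open>\<box>\<not>\<beta>\<close> hold at \<open>w\<close>, and accessibility is pushed forward to these valuations. Distinct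
  worlds may induce the same valuation on \<open>\<Lambda>\<close>, so paths of valuations need not come from paths of
  worlds. This is harmless for all conditions that concern a single edge; only the second half of
  condition (5) involves two edges. There one restricts to the worlds reachable from \<open>a\<close>: the
  proper successors of \<open>a\<close> under a Euclidean relation form a cluster, on which the sets of
  necessary and of impossible formulas are constant.\<close>

section \<open>Derivations from hypotheses\<close>

text \<open>Necessitation acts inside \<open>thms\<close> only and never on hypotheses, which is
  what makes the deduction theorem hold for these modal logics.\<close>

inductive_set conseqs :: "cube \<Rightarrow> 'p fm set \<Rightarrow> 'p fm set" for L \<Gamma> where
  Hyp: "\<alpha> \<in> \<Gamma> \<Longrightarrow> \<alpha> \<in> conseqs L \<Gamma>"
| Thm: "\<alpha> \<in> thms L \<Longrightarrow> \<alpha> \<in> conseqs L \<Gamma>"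
| Mp: "\<alpha> \<^bold>\<rightarrow> \<beta> \<in> conseqs L \<Gamma> \<Longrightarrow> \<alpha> \<in> conseqs L \<Gamma> \<Longrightarrow> \<beta> \<in> conseqs L \<Gamma>"

lemma Imp_refl_thm: "\<alpha> \<^bold>\<rightarrow> \<alpha> \<in> thms L"
  using thms.MP[OF thms.MP[OF thms.P2 thms.P1] thms.P1[of \<alpha> \<alpha> L]] .

lemma conseqs_Imp_weaken: "\<beta> \<in> conseqs L \<Gamma> \<Longrightarrow> \<alpha> \<^bold>\<rightarrow> \<beta> \<in> conseqs L \<Gamma>"
  using conseqs.Mp[OF conseqs.Thm[OF thms.P1]] .

lemma deduction:
  "\<beta> \<in> conseqs L (insert \<alpha> \<Gamma>) \<Longrightarrow> \<alpha> \<^bold>\<rightarrow> \<beta> \<in> conseqs L \<Gamma>"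
proof (induction rule: conseqs.induct)
  case (Hyp \<beta>)
  then show ?case
    by (auto intro: conseqs.Thm Imp_refl_thm conseqs_Imp_weaken conseqs.Hyp)
next
  case (Thm \<beta>)
  then show ?case by (intro conseqs_Imp_weaken) (rule conseqs.Thm)
next
  case (Mp \<beta> \<gamma>)
  then show ?case
    using conseqs.Mp[OF conseqs.Mp[OF conseqs.Thm[OF thms.P2]]] by blast
qed

lemma conseqs_cut: "\<beta> \<in> conseqs L \<Delta> \<Longrightarrow> \<Delta> \<subseteq> conseqs L \<Gamma> \<Longrightarrow> \<beta> \<in> conseqs L \<Gamma>"
  by (induction rule: conseqs.induct) (auto intro: conseqs.intros)

lemma conseqs_mono: "\<beta> \<in> conseqs L \<Delta> \<Longrightarrow> \<Delta> \<subseteq> \<Gamma> \<Longrightarrow> \<beta> \<in> conseqs L \<Gamma>"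
  by (erule conseqs_cut) (auto intro: conseqs.Hyp)

lemma conseqs_empty: "conseqs L {} = thms L"
proof
  show "conseqs L {} \<subseteq> thms L"
  proof
    show "\<alpha> \<in> thms L" if "\<alpha> \<in> conseqs L {}" for \<alpha>
      using that by induction (auto intro: thms.MP)
  qed
qed (auto intro: conseqs.Thm)

lemma conseqs_finite:
  "\<beta> \<in> conseqs L \<Gamma> \<Longrightarrow> \<exists>\<Delta>. finite \<Delta> \<and> \<Delta> \<subseteq> \<Gamma> \<and> \<beta> \<in> conseqs L \<Delta>"
proof (induction rule: conseqs.induct)
  case (Hyp \<alpha>)
  then show ?case by (intro exI[of _ "{\<alpha>}"]) (auto intro: conseqs.Hyp)
next
  case (Thm \<alpha>)
  then show ?case by (intro exI[of _ "{}"]) (auto intro: conseqs.Thm)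
next
  case (Mp \<alpha> \<beta>)
  then obtain \<Delta> \<Delta>' where "finite \<Delta>" "\<Delta> \<subseteq> \<Gamma>" "\<alpha> \<^bold>\<rightarrow> \<beta> \<in> conseqs L \<Delta>"
    "finite \<Delta>'" "\<Delta>' \<subseteq> \<Gamma>" "\<alpha> \<in> conseqs L \<Delta>'" by blast
  then show ?case
    by (intro exI[of _ "\<Delta> \<union> \<Delta>'"])
      (auto intro: conseqs.Mp conseqs_mono[of _ L \<Delta>] conseqs_mono[of _ L \<Delta>'])
qed

lemma conseqs_contradiction: "\<^bold>\<bottom> \<in> conseqs L (insert (\<^bold>\<not> \<alpha>) \<Gamma>) \<Longrightarrow> \<alpha> \<in> conseqs L \<Gamma>"
  using conseqs.Mp[OF conseqs.Thm[OF thms.P3]] deduction by blast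

lemma conseqs_explosion: "\<^bold>\<bottom> \<in> conseqs L \<Gamma> \<Longrightarrow> \<alpha> \<in> conseqs L \<Gamma>"
  by (meson conseqs_contradiction conseqs_mono subset_insertI)

text \<open>Conjunction abbreviates a negated implication, so each conjunct follows by
  contradiction: its negation derives that implication, by explosion for the first conjunct and by
  weakening for the second.\<close>

lemma conseqs_Con:
  shows conseqs_Con1: "\<alpha> \<in> conseqs L {\<alpha> \<^bold>\<and> \<beta>}"
    and conseqs_Con2: "\<beta> \<in> conseqs L {\<alpha> \<^bold>\<and> \<beta>}"
proof -
  have "\<alpha> \<^bold>\<rightarrow> \<^bold>\<not> \<beta> \<in> conseqs L {\<^bold>\<not> \<alpha>, \<alpha> \<^bold>\<and> \<beta>}"
  proof (rule deduction)
    have "\<^bold>\<bottom> \<in> conseqs L {\<alpha>, \<^bold>\<not> \<alpha>, \<alpha> \<^bold>\<and> \<beta>}"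
      by (rule conseqs.Mp[of \<alpha>]) (auto intro: conseqs.Hyp)
    then show "\<^bold>\<not> \<beta> \<in> conseqs L {\<alpha>, \<^bold>\<not> \<alpha>, \<alpha> \<^bold>\<and> \<beta>}"
      by (rule conseqs_explosion)
  qed
  then show "\<alpha> \<in> conseqs L {\<alpha> \<^bold>\<and> \<beta>}"
    by (rule conseqs_contradiction[OF conseqs.Mp, rotated]) (simp add: conseqs.Hyp)
  have "\<alpha> \<^bold>\<rightarrow> \<^bold>\<not> \<beta> \<in> conseqs L {\<^bold>\<not> \<beta>, \<alpha> \<^bold>\<and> \<beta>}"
    by (intro conseqs_Imp_weaken conseqs.Hyp) simp
  then show "\<beta> \<in> conseqs L {\<alpha> \<^bold>\<and> \<beta>}"
    by (rule conseqs_contradiction[OF conseqs.Mp, rotated]) (simp add: conseqs.Hyp)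
qed

lemma conseqs_foldl_Con: "set (\<gamma> # \<gamma>s) \<subseteq> conseqs L {foldl Con \<gamma> \<gamma>s}"
\<comment> \<open>\<open>foldl\<close> nests to the left, so a premise appended at the end becomes
  the outermost right conjunct.\<close>
proof (induction \<gamma>s rule: rev_induct)
  case Nil
  then show ?case by (auto intro: conseqs.Hyp)
next
  case (snoc \<delta> \<gamma>s)
  let ?\<phi> = "foldl Con \<gamma> \<gamma>s"
  have "conseqs L {?\<phi>} \<subseteq> conseqs L {?\<phi> \<^bold>\<and> \<delta>}"
    using conseqs_Con1 conseqs_cut by blast
  then show ?case using snoc conseqs_Con2 by auto
qed

lemma conseqs_imp_derives:
  assumes "\<alpha> \<in> conseqs L \<Gamma>"
  shows "\<Gamma> \<turnstile>\<^bsub>L\<^esub> \<alpha>"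
proof -
  obtain \<gamma>s where \<gamma>s: "set \<gamma>s \<subseteq> \<Gamma>" "\<alpha> \<in> conseqs L (set \<gamma>s)"
    using conseqs_finite[OF assms] finite_list by metis
  show ?thesis
  \<comment> \<open>The premise list in \<open>derives\<close> is nonempty; a derivation without
    premises falls under its first alternative.\<close>
  proof (cases \<gamma>s)
    case Nil
    then show ?thesis using \<gamma>s by (simp add: conseqs_empty derives_def)
  next
    case (Cons \<gamma> \<gamma>s')
    then have "\<alpha> \<in> conseqs L {foldl Con \<gamma> \<gamma>s'}"
      using \<gamma>s(2) conseqs_foldl_Con conseqs_cut by blast
    then have "foldl Con \<gamma> \<gamma>s' \<^bold>\<rightarrow> \<alpha> \<in> thms L"
      using deduction conseqs_empty by blast
    then show ?thesis using Cons \<gamma>s(1) unfolding derives_def by blast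
  qed
qed


section \<open>The canonical model\<close>

definition MCS :: "cube \<Rightarrow> 'p fm set \<Rightarrow> bool" where
  "MCS L w \<longleftrightarrow> \<^bold>\<bottom> \<notin> conseqs L w \<and> (\<forall>\<beta>. \<beta> \<in> w \<or> \<^bold>\<not> \<beta> \<in> w)"

text \<open>Zorn's lemma instead of an enumeration of formulas allows any type of atoms. Derivations
  use finitely many hypotheses, so unions of nonempty chains of consistent sets are
  consistent.\<close>

lemma Lindenbaum:
  assumes "\<^bold>\<bottom> \<notin> conseqs L \<Gamma>"
  obtains w where "MCS L w" "\<Gamma> \<subseteq> w"
proof -
  let ?A = "{\<Delta>. \<Gamma> \<subseteq> \<Delta> \<and> \<^bold>\<bottom> \<notin> conseqs L \<Delta>}"
  have "\<Union>C \<in> ?A" if C: "C \<noteq> {}" "subset.chain ?A C" for C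
  proof -
    have "\<^bold>\<bottom> \<notin> conseqs L (\<Union>C)"
    proof
      assume "\<^bold>\<bottom> \<in> conseqs L (\<Union>C)"
      then obtain \<Delta> where \<Delta>: "finite \<Delta>" "\<Delta> \<subseteq> \<Union>C" "\<^bold>\<bottom> \<in> conseqs L \<Delta>"
        using conseqs_finite by metis
      then obtain X where "X \<in> C" "\<Delta> \<subseteq> X"
        using finite_subset_Union_chain[OF \<Delta>(1,2) C] by blast
      moreover have "X \<in> ?A" using \<open>X \<in> C\<close> C unfolding subset.chain_def by blast
      ultimately show False using conseqs_mono[OF \<Delta>(3)] by simp
    qed
    then show ?thesis using C unfolding subset.chain_def by blast
  qed
  moreover have "?A \<noteq> {}" using assms by blast
  ultimately have "\<exists>w\<in>?A. \<forall>X\<in>?A. w \<subseteq> X \<longrightarrow> X = w"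
    by (intro subset_Zorn_nonempty)
  then obtain w where w: "w \<in> ?A" and max: "\<forall>X\<in>?A. w \<subseteq> X \<longrightarrow> X = w"
    by (rule bexE)
  have "\<beta> \<in> w \<or> \<^bold>\<not> \<beta> \<in> w" for \<beta>
  proof (rule ccontr)
    assume not: "\<not> (\<beta> \<in> w \<or> \<^bold>\<not> \<beta> \<in> w)"
    \<comment> \<open>By maximality, adding any missing formula gives inconsistency. If \<beta> and
      its negation were both missing, \<open>w\<close> would derive both.\<close>
    have "\<^bold>\<bottom> \<in> conseqs L (insert \<phi> w)" if "\<phi> \<notin> w" for \<phi>
      using max[rule_format, of "insert \<phi> w"] w that by auto
    with not have "\<beta> \<in> conseqs L w" "\<^bold>\<not> \<beta> \<in> conseqs L w"
      by (simp_all add: conseqs_contradiction deduction)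
    then show False using w conseqs.Mp[of \<beta> "\<^bold>\<bottom>" L w] by simp
  qed
  then show ?thesis using that[of w] w unfolding MCS_def by simp
qed

lemma MCS_conseqs: "MCS L w \<Longrightarrow> \<beta> \<in> conseqs L w \<longleftrightarrow> \<beta> \<in> w"
  unfolding MCS_def by (metis conseqs.Hyp conseqs.Mp)

lemma MCS_thms: "MCS L w \<Longrightarrow> \<beta> \<in> thms L \<Longrightarrow> \<beta> \<in> w"
  using MCS_conseqs conseqs.Thm by blast

lemma MCS_MP: "MCS L w \<Longrightarrow> \<alpha> \<^bold>\<rightarrow> \<beta> \<in> w \<Longrightarrow> \<alpha> \<in> w \<Longrightarrow> \<beta> \<in> w"
  using MCS_conseqs conseqs.Mp by blast

lemma MCS_Bot: "MCS L w \<Longrightarrow> \<^bold>\<bottom> \<notin> w"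
  unfolding MCS_def by (meson conseqs.Hyp)

lemma MCS_Imp: "MCS L w \<Longrightarrow> \<alpha> \<^bold>\<rightarrow> \<beta> \<in> w \<longleftrightarrow> (\<alpha> \<in> w \<longrightarrow> \<beta> \<in> w)"
proof
  assume w: "MCS L w" and imp: "\<alpha> \<in> w \<longrightarrow> \<beta> \<in> w"
  show "\<alpha> \<^bold>\<rightarrow> \<beta> \<in> w"
  proof (cases "\<alpha> \<in> w")
    case True
    then show ?thesis using imp MCS_conseqs[OF w] conseqs_Imp_weaken by metis
  next
    case False
    then have "\<^bold>\<not> \<alpha> \<in> w" using w unfolding MCS_def by blast
    then have "\<^bold>\<bottom> \<in> conseqs L (insert \<alpha> w)"
      by (intro conseqs.Mp[of \<alpha>, OF conseqs.Hyp conseqs.Hyp]) simp_all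
    then have "\<alpha> \<^bold>\<rightarrow> \<beta> \<in> conseqs L w"
      by (rule deduction[OF conseqs_explosion])
    then show ?thesis using MCS_conseqs[OF w] by simp
  qed
qed (use MCS_MP in blast)

lemma MCS_Box_mono: "MCS L w \<Longrightarrow> \<alpha> \<^bold>\<rightarrow> \<beta> \<in> thms L \<Longrightarrow> \<^bold>\<box> \<alpha> \<in> w \<Longrightarrow> \<^bold>\<box> \<beta> \<in> w"
  by (meson MCS_MP MCS_thms thms.Nec thms.k)

lemma double_negation_thm: "\<alpha> \<^bold>\<rightarrow> \<^bold>\<not> \<^bold>\<not> \<alpha> \<in> thms L"
proof -
  have "\<^bold>\<bottom> \<in> conseqs L {\<^bold>\<not> \<alpha>, \<alpha>}"
    by (rule conseqs.Mp[of \<alpha>]) (auto intro: conseqs.Hyp)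
  then show ?thesis using deduction conseqs_empty by metis
qed

section \<open>Canonical accessibility and its frame conditions\<close>

definition canonical_rel :: "cube \<Rightarrow> 'p fm set rel" where
  "canonical_rel L = {(w, u). MCS L w \<and> MCS L u \<and> (\<forall>\<beta>. \<^bold>\<box> \<beta> \<in> w \<longrightarrow> \<beta> \<in> u)}"

text \<open>A derivation from the formulas necessary at \<open>w\<close> can be boxed line by line:
  theorems by \<open>Nec\<close>, modus ponens by \<open>k\<close>.\<close>

lemma Box_conseqs:
  assumes "\<beta> \<in> conseqs L {\<beta>. \<^bold>\<box> \<beta> \<in> w}" and w: "MCS L w"
  shows "\<^bold>\<box> \<beta> \<in> w"
  using assms(1)
proof induction
  case (Mp \<alpha> \<beta>)
  then show ?case using MCS_MP[OF w MCS_MP[OF w MCS_thms[OF w thms.k]]] by simp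
qed (use w in \<open>simp_all add: MCS_thms thms.Nec\<close>)

text \<open>If the negation of \<beta> were inconsistent with the formulas necessary at
  \<open>w\<close>, these would derive \<beta>, and \<open>Box_conseqs\<close> would make \<beta>
  necessary at \<open>w\<close>.\<close>

lemma canonical_existence:
  assumes w: "MCS L w" and "\<^bold>\<box> \<beta> \<notin> w"
  obtains u where "(w, u) \<in> canonical_rel L" "\<beta> \<notin> u"
proof -
  have "\<^bold>\<bottom> \<notin> conseqs L (insert (\<^bold>\<not> \<beta>) {\<beta>. \<^bold>\<box> \<beta> \<in> w})"
    using assms(2) Box_conseqs[OF _ w] conseqs_contradiction[of L \<beta>] by metis
  then obtain u where u: "MCS L u" "insert (\<^bold>\<not> \<beta>) {\<beta>. \<^bold>\<box> \<beta> \<in> w} \<subseteq> u"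
    by (rule Lindenbaum)
  have "\<^bold>\<not> \<beta> \<in> u" using u(2) by simp
  then have "\<beta> \<notin> u" using MCS_MP[OF u(1)] MCS_Bot[OF u(1)] by metis
  moreover have "(w, u) \<in> canonical_rel L" using u w by (auto simp: canonical_rel_def)
  ultimately show ?thesis using that by simp
qed

text \<open>\<open>U\<close> separates the worlds from the rest of the type: in the canonical model
  the type also contains sets that are not maximal consistent.\<close>

primrec frame_cond :: "scheme \<Rightarrow> 'w set \<Rightarrow> 'w rel \<Rightarrow> bool" where
  "frame_cond Ax_D U R \<longleftrightarrow> (\<forall>w\<in>U. \<exists>u. (w, u) \<in> R)"
| "frame_cond Ax_T U R \<longleftrightarrow> (\<forall>w\<in>U. (w, w) \<in> R)"
| "frame_cond Ax_B U R \<longleftrightarrow> sym R"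
| "frame_cond Ax_4 U R \<longleftrightarrow> trans R"
| "frame_cond Ax_5 U R \<longleftrightarrow> (\<forall>w u u'. (w, u) \<in> R \<and> (w, u') \<in> R \<longrightarrow> (u, u') \<in> R)"

text \<open>The hypothesis is derivability rather than membership in \<open>schemes L\<close>,
  because \<open>L_model\<close> imposes a condition for every derivable scheme, such as (D) in
  \<open>KT\<close>.\<close>

lemma canonical_frame_cond:
  fixes L :: cube
  assumes thms: "\<And>\<alpha>::'p fm. scheme_inst s \<alpha> \<in> thms L"
  shows "frame_cond s {w::'p fm set. MCS L w} (canonical_rel L)"
proof -
  have inst: "scheme_inst s \<alpha> \<in> w" if "MCS L w" for w and \<alpha> :: "'p fm"
    using that thms MCS_thms by blast
  \<comment> \<open>The diamond of a negation unfolds to a formula with a double negation under the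
    box; this form of a necessary formula contradicts it directly.\<close>
  have nn: "\<^bold>\<box> \<^bold>\<not> \<^bold>\<not> \<beta> \<in> w" if "MCS L w" "\<^bold>\<box> \<beta> \<in> w" for w and \<beta> :: "'p fm"
    using that MCS_Box_mono double_negation_thm by blast
  show ?thesis
  proof (cases s)
    case Ax_D
    have "\<exists>u. (w, u) \<in> canonical_rel L" if w: "MCS L w" for w :: "'p fm set"
    proof -
      \<comment> \<open>Instantiating (D) with verum yields a formula that is not necessary at
        \<open>w\<close>, and hence a successor.\<close>
      have "\<^bold>\<box> \<^bold>\<not> \<^bold>\<bottom> \<in> w" by (rule MCS_thms[OF w thms.Nec[OF Imp_refl_thm]])
      moreover have "\<^bold>\<box> \<^bold>\<not> \<^bold>\<bottom> \<^bold>\<rightarrow> \<^bold>\<diamond> \<^bold>\<not> \<^bold>\<bottom> \<in> w" using inst[OF w, of "\<^bold>\<not> \<^bold>\<bottom>"] Ax_D by simp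
      ultimately have "\<^bold>\<box> \<^bold>\<not> \<^bold>\<not> \<^bold>\<bottom> \<notin> w" using w MCS_MP MCS_Bot by blast
      then show ?thesis using canonical_existence[OF w] by metis
    qed
    then show ?thesis using Ax_D by simp
  next
    case Ax_T
    then show ?thesis using inst MCS_MP unfolding canonical_rel_def by fastforce
  next
    case Ax_B
    have "(u, w) \<in> canonical_rel L" if "(w, u) \<in> canonical_rel L" for w u :: "'p fm set"
    proof -
      have wu: "MCS L w" "MCS L u" "\<And>\<beta>. \<^bold>\<box> \<beta> \<in> w \<Longrightarrow> \<beta> \<in> u"
        using that unfolding canonical_rel_def by auto
      have "\<beta> \<in> w" if "\<^bold>\<box> \<beta> \<in> u" for \<beta>
      proof (rule ccontr)
        assume "\<beta> \<notin> w"
        then have "\<^bold>\<not> \<beta> \<in> w" using wu(1) by (simp add: MCS_Imp)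
        moreover have "\<^bold>\<not> \<beta> \<^bold>\<rightarrow> \<^bold>\<box> \<^bold>\<diamond> \<^bold>\<not> \<beta> \<in> w" using inst[OF wu(1), of "\<^bold>\<not> \<beta>"] Ax_B by simp
        ultimately have "\<^bold>\<diamond> \<^bold>\<not> \<beta> \<in> u" using wu MCS_MP by blast
        then show False using nn[OF wu(2) that] wu(2) MCS_MP MCS_Bot by blast
      qed
      then show ?thesis using wu unfolding canonical_rel_def by blast
    qed
    then show ?thesis using Ax_B by (auto intro: symI)
  next
    case Ax_4
    have "\<^bold>\<box> \<^bold>\<box> \<beta> \<in> w" if "MCS L w" "\<^bold>\<box> \<beta> \<in> w" for w and \<beta> :: "'p fm"
      using inst[OF that(1), of \<beta>] that Ax_4 MCS_MP by auto
    then show ?thesis using Ax_4 unfolding canonical_rel_def by (auto intro!: transI)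
  next
    case Ax_5
    have "(u, u') \<in> canonical_rel L"
      if "(w, u) \<in> canonical_rel L" "(w, u') \<in> canonical_rel L" for w u u' :: "'p fm set"
    proof -
      have w: "MCS L w" "MCS L u" "MCS L u'"
        "\<And>\<beta>. \<^bold>\<box> \<beta> \<in> w \<Longrightarrow> \<beta> \<in> u" "\<And>\<beta>. \<^bold>\<box> \<beta> \<in> w \<Longrightarrow> \<beta> \<in> u'"
        using that unfolding canonical_rel_def by auto
      have "\<beta> \<in> u'" if "\<^bold>\<box> \<beta> \<in> u" for \<beta>
      proof (rule ccontr)
        assume "\<beta> \<notin> u'"
        then have "\<^bold>\<not> \<^bold>\<not> \<beta> \<notin> u'" using w(3) MCS_Bot by (auto simp: MCS_Imp)
        then have "\<^bold>\<diamond> \<^bold>\<not> \<beta> \<in> w" using w(1,5) by (auto simp: MCS_Imp)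
        moreover have "\<^bold>\<diamond> \<^bold>\<not> \<beta> \<^bold>\<rightarrow> \<^bold>\<box> \<^bold>\<diamond> \<^bold>\<not> \<beta> \<in> w" using inst[OF w(1), of "\<^bold>\<not> \<beta>"] Ax_5 by simp
        ultimately have "\<^bold>\<diamond> \<^bold>\<not> \<beta> \<in> u" using w(1,4) MCS_MP by blast
        then show False using nn[OF w(2) that] w(2) MCS_MP MCS_Bot by blast
      qed
      then show ?thesis using w unfolding canonical_rel_def by blast
    qed
    then show ?thesis using Ax_5 by auto
  qed
qed

text \<open>Levels are defined from satisfaction rather than from membership in a maximal consistent
  set, so the tables can be verified on arbitrary Kripke frames.\<close>

primrec sat :: "'w rel \<Rightarrow> ('w \<Rightarrow> 'p \<Rightarrow> bool) \<Rightarrow> 'w \<Rightarrow> 'p fm \<Rightarrow> bool" where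
  "sat R V w (Atom p) \<longleftrightarrow> V w p"
| "sat R V w \<^bold>\<bottom> \<longleftrightarrow> False"
| "sat R V w (\<alpha> \<^bold>\<rightarrow> \<beta>) \<longleftrightarrow> (sat R V w \<alpha> \<longrightarrow> sat R V w \<beta>)"
| "sat R V w (\<^bold>\<box> \<alpha>) \<longleftrightarrow> (\<forall>u. (w, u) \<in> R \<longrightarrow> sat R V u \<alpha>)"

lemma canonical_truth:
  "MCS L w \<Longrightarrow> sat (canonical_rel L) (\<lambda>w p. Atom p \<in> w) w \<beta> \<longleftrightarrow> \<beta> \<in> w"
proof (induction \<beta> arbitrary: w)
  case (Box \<beta>)
  have "sat (canonical_rel L) (\<lambda>w p. Atom p \<in> w) w (\<^bold>\<box> \<beta>)
      \<longleftrightarrow> (\<forall>u. (w, u) \<in> canonical_rel L \<longrightarrow> \<beta> \<in> u)"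
    using Box.IH by (auto simp: canonical_rel_def)
  also have "\<dots> \<longleftrightarrow> \<^bold>\<box> \<beta> \<in> w"
    using canonical_existence[OF Box.prems] unfolding canonical_rel_def by blast
  finally show ?case .
qed (auto simp: MCS_Bot MCS_Imp)


section \<open>Levels of formulas at a world\<close>

text \<open>The eight truth values encode three bits: membership in \<open>Des\<close>, \<open>NN\<close> and \<open>II\<close>.\<close>

definition level :: "bool \<Rightarrow> bool \<Rightarrow> bool \<Rightarrow> val" where
  "level d n i =
    (if d then if n then if i then Vt2 else VT else if i then Vt3 else Vt
     else if n then if i then Vf2 else Vf3 else if i then VF else Vf)"

text \<open>Possible means not impossible, and possibly false means not necessary: \<open>PP\<close>
  and \<open>PN\<close> are the complements of \<open>II\<close> and \<open>NN\<close>.\<close>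

lemma level_Des [simp]: "level d n i \<in> Des \<longleftrightarrow> d"
  and level_NN [simp]: "level d n i \<in> NN \<longleftrightarrow> n"
  and level_II [simp]: "level d n i \<in> II \<longleftrightarrow> i"
  and level_PP [simp]: "level d n i \<in> PP \<longleftrightarrow> \<not> i"
  and level_PN [simp]: "level d n i \<in> PN \<longleftrightarrow> \<not> n"
  by (auto simp: level_def Des_def NN_def II_def PP_def PN_def)

text \<open>Both modal bits hold exactly at worlds without successors; there only \<open>Vf2\<close>
  and \<open>Vt2\<close> occur.\<close>

definition world_val :: "'w rel \<Rightarrow> ('w \<Rightarrow> 'p \<Rightarrow> bool) \<Rightarrow> 'w \<Rightarrow> 'p fm \<Rightarrow> val" where
  "world_val R V w \<beta> =
    level (sat R V w \<beta>) (\<forall>u. (w, u) \<in> R \<longrightarrow> sat R V u \<beta>) (\<forall>u. (w, u) \<in> R \<longrightarrow> \<not> sat R V u \<beta>)"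

text \<open>The bit \<open>n\<close> of the implication is not determined by the bits of its
  components; this is the source of the two-valued table entries. The last hypothesis holds because
  both of its sides say that there are no successors.\<close>

lemma level_imp_tab:
  assumes "i1 \<longrightarrow> n" "n2 \<longrightarrow> n" "n \<and> n1 \<longrightarrow> n2" "n \<and> i2 \<longrightarrow> i1" "n1 \<and> i1 \<longleftrightarrow> n2 \<and> i2"
  shows "level (d1 \<longrightarrow> d2) n (n1 \<and> i2) \<in> imp_tab (level d1 n1 i1) (level d2 n2 i2)"
  using assms
  by (cases d1; cases n1; cases i1; cases d2; cases n2; cases i2; cases n) (simp_all add: level_def)

lemma world_val_Imp:
  "world_val R V w (\<beta> \<^bold>\<rightarrow> \<gamma>) \<in> imp_tab (world_val R V w \<beta>) (world_val R V w \<gamma>)"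
proof -
  have "(\<forall>u. (w, u) \<in> R \<longrightarrow> \<not> sat R V u (\<beta> \<^bold>\<rightarrow> \<gamma>)) \<longleftrightarrow>
      (\<forall>u. (w, u) \<in> R \<longrightarrow> sat R V u \<beta>) \<and> (\<forall>u. (w, u) \<in> R \<longrightarrow> \<not> sat R V u \<gamma>)"
    by auto
  then show ?thesis
    unfolding world_val_def sat.simps(3)[of R V w] by (simp only:) (rule level_imp_tab; auto)
qed

text \<open>Under (B) and (4) a world is a dead end or reflexive, which excludes \<open>Vf3\<close>
  and \<open>Vt3\<close> in \<open>KB5\<close>.\<close>

lemma level_vals:
  assumes "Ax_D \<in> schemes L \<Longrightarrow> \<not> (n \<and> i)"
    and "Ax_T \<in> schemes L \<Longrightarrow> (n \<longrightarrow> d) \<and> (i \<longrightarrow> \<not> d)"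
    and "Ax_B \<in> schemes L \<and> Ax_4 \<in> schemes L \<Longrightarrow> n \<and> i \<or> (n \<longrightarrow> d) \<and> (i \<longrightarrow> \<not> d)"
  shows "level d n i \<in> vals L"
  using assms by (cases d; cases n; cases i; cases L) (simp_all add: level_def vals_def)

text \<open>The designation bit of the boxed formula is \<open>n1\<close>, the necessity bit of its
  argument; \<open>n\<close> and \<open>i\<close> are its own modal bits. Each hypothesis states
  what one frame property yields. The one for (D) with (4) gives the entries of \<open>KD4\<close>
  at \<open>VF\<close> and \<open>Vt3\<close>; the one for (B) with (4) excludes arguments outside
  the values of \<open>KB5\<close>.\<close>

lemma level_box_tab:
  assumes "n \<and> i \<longleftrightarrow> n1 \<and> i1"
    and "Ax_D \<in> schemes L \<Longrightarrow> \<not> (n \<and> i)"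
    and "Ax_T \<in> schemes L \<Longrightarrow> (n1 \<longrightarrow> d1) \<and> (i1 \<longrightarrow> \<not> d1) \<and> (n \<longrightarrow> n1) \<and> (i \<longrightarrow> \<not> n1) \<and> (i1 \<longrightarrow> i)"
    and "Ax_B \<in> schemes L \<Longrightarrow> d1 \<or> i"
    and "Ax_4 \<in> schemes L \<Longrightarrow> n1 \<longrightarrow> n"
    and "Ax_5 \<in> schemes L \<Longrightarrow> (n1 \<or> i) \<and> (n \<or> i)"
    and "Ax_D \<in> schemes L \<and> Ax_4 \<in> schemes L \<Longrightarrow> i1 \<longrightarrow> i"
    and "Ax_B \<in> schemes L \<and> Ax_4 \<in> schemes L \<Longrightarrow> n1 \<and> i1 \<or> (n1 \<longrightarrow> d1) \<and> (i1 \<longrightarrow> \<not> d1)"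
  shows "level n1 n i \<in> box_tab L (level d1 n1 i1)"
  by (insert assms, atomize (full), cases d1; cases n1; cases i1; cases n; cases i; cases L;
      simp add: level_def)

section \<open>Valuations induced by an arbitrary Kripke frame for \<open>L\<close>\<close>

context
  fixes L :: cube and U :: "'w set" and R :: "'w rel"
  assumes frame: "\<And>s. s \<in> schemes L \<Longrightarrow> frame_cond s U R"
    and R_sub: "R \<subseteq> U \<times> U"
begin

text \<open>Step to \<open>u\<close> and back: symmetry and transitivity make every world with a
  successor reflexive.\<close>

lemma frame_B4_refl:
  assumes "Ax_B \<in> schemes L \<and> Ax_4 \<in> schemes L" "(w, u) \<in> R"
  shows "(w, w) \<in> R"
  using assms frame[of Ax_B] frame[of Ax_4] by (auto dest: symD transD)

lemma world_val_vals:
  assumes "w \<in> U"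
  shows "world_val R V w \<beta> \<in> vals L"
  unfolding world_val_def
proof (rule level_vals, goal_cases)
  case 1
  then show ?case using frame[of Ax_D] assms by auto
next
  case 2
  then show ?case using frame[of Ax_T] assms by auto
next
  case 3
  then show ?case using frame_B4_refl[OF 3] by blast
qed

lemma world_val_Box:
  assumes "w \<in> U"
  shows "world_val R V w (\<^bold>\<box> \<beta>) \<in> box_tab L (world_val R V w \<beta>)"
  unfolding world_val_def sat.simps(4)[of R V w]
proof (rule level_box_tab, goal_cases)
  case 1
  then show ?case by auto
next
  case 2
  then obtain u where "(w, u) \<in> R" using frame[of Ax_D] assms by auto
  then show ?case by blast
next
  case 3
  then have "\<forall>w\<in>U. (w, w) \<in> R" using frame[of Ax_T] by simp
  moreover have "u \<in> U" if "(w, u) \<in> R" for u using that R_sub by blast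
  ultimately show ?case using assms by auto
next
  case 4
  then show ?case using frame[of Ax_B] by (auto dest: symD)
next
  case 5
  then show ?case using frame[of Ax_4] by (auto dest: transD)
next
  case 6
  have eucl: "(u, u') \<in> R" if "(x, u) \<in> R" "(x, u') \<in> R" for x u u'
    using frame[OF 6, unfolded frame_cond.simps] that by metis
  \<comment> \<open>Successors \<open>u\<close> and \<open>u'\<close> of \<open>w\<close> see each
    other, so every successor of \<open>u'\<close> is also one of \<open>u\<close>.\<close>
  have "sat R V u' \<beta> \<and> sat R V u' (\<^bold>\<box> \<beta>)"
    if u: "(w, u) \<in> R" "sat R V u (\<^bold>\<box> \<beta>)" and u': "(w, u') \<in> R" for u u'
    using u(2) eucl[OF u(1) u'] eucl[OF eucl[OF u' u(1)]] by simp
  then show ?case by blast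
next
  case 7
  then have "trans R" "\<forall>w\<in>U. \<exists>u. (w, u) \<in> R" using frame[of Ax_4] frame[of Ax_D] by auto
  moreover have "u \<in> U" if "(w, u) \<in> R" for u using that R_sub by blast
  \<comment> \<open>The successor \<open>x\<close> that seriality gives to \<open>u\<close> is also
    seen from \<open>w\<close>; if \<beta> fails at all successors of \<open>w\<close>, it is not
    necessary at \<open>u\<close>.\<close>
  ultimately have "\<exists>x. (u, x) \<in> R \<and> (w, x) \<in> R" if "(w, u) \<in> R" for u
    using that by (meson transD)
  then show ?case by fastforce
next
  case 8
  then show ?case using frame_B4_refl[OF 8] by blast
qed

lemma world_val_partial_vals:
  assumes "w \<in> U" "subformula_closed \<Lambda>"
  shows "restrict (world_val R V w) \<Lambda> \<in> partial_vals L \<Lambda>"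
proof -
  have self: "\<beta> \<in> subformulas \<beta>" for \<beta> :: "'c fm" by (cases \<beta>) auto
  have sub: "subformulas \<beta> \<subseteq> \<Lambda>" if "\<beta> \<in> \<Lambda>" for \<beta>
    using that assms(2) unfolding subformula_closed_def by blast
  have Imp: "\<beta> \<in> \<Lambda>" "\<gamma> \<in> \<Lambda>" if "\<beta> \<^bold>\<rightarrow> \<gamma> \<in> \<Lambda>" for \<beta> \<gamma>
    using sub[OF that] self[of \<beta>] self[of \<gamma>] by auto
  have Box: "\<beta> \<in> \<Lambda>" if "\<^bold>\<box> \<beta> \<in> \<Lambda>" for \<beta>
    using sub[OF that] self[of \<beta>] by auto
  show ?thesis
    unfolding partial_vals_def
  proof (intro CollectI conjI allI impI)
    show "restrict (world_val R V w) \<Lambda> \<in> \<Lambda> \<rightarrow>\<^sub>E vals L"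
      by (simp add: world_val_vals assms(1))
  next
    show "restrict (world_val R V w) \<Lambda> \<^bold>\<bottom> \<in> bot_tab" if "\<^bold>\<bottom> \<in> \<Lambda>"
      using that by (simp add: world_val_def level_def bot_tab_def)
  next
    fix \<beta> \<gamma> assume "\<beta> \<^bold>\<rightarrow> \<gamma> \<in> \<Lambda>"
    then show "restrict (world_val R V w) \<Lambda> (\<beta> \<^bold>\<rightarrow> \<gamma>) \<in>
        imp_tab (restrict (world_val R V w) \<Lambda> \<beta>) (restrict (world_val R V w) \<Lambda> \<gamma>)"
      using Imp[of \<beta> \<gamma>] by (simp add: world_val_Imp)
  next
    fix \<beta> assume "\<^bold>\<box> \<beta> \<in> \<Lambda>"
    then show "restrict (world_val R V w) \<Lambda> (\<^bold>\<box> \<beta>) \<in> box_tab L (restrict (world_val R V w) \<Lambda> \<beta>)"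
      using Box[of \<beta>] by (simp add: world_val_Box assms(1))
  qed
qed

end


section \<open>The model of valuations reachable from a world\<close>

text \<open>The first world \<open>e\<close> on a path from \<open>a\<close> sees everything
  properly reachable from \<open>a\<close>; two worlds seen from \<open>e\<close> see each
  other.\<close>

lemma euclidean_cluster:
  assumes eucl: "\<And>w u u'. (w, u) \<in> R \<Longrightarrow> (w, u') \<in> R \<Longrightarrow> (u, u') \<in> R"
    and b: "(a, b) \<in> R\<^sup>+" and c: "(a, c) \<in> R\<^sup>+"
  shows "(b, c) \<in> R"
proof -
  obtain e where e: "(a, e) \<in> R" using b by (meson tranclD)
  have "(e, d) \<in> R" if "(a, d) \<in> R\<^sup>+" for d
    using that
  proof induction
    case (base d)
    then show ?case using e eucl by blast
  next
    case (step c d)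
    \<comment> \<open>\<open>e\<close> sees itself, so \<open>c\<close> sees \<open>e\<close> as
      well as \<open>d\<close>, and hence \<open>e\<close> sees \<open>d\<close>.\<close>
    then show ?case using e eucl by meson
  qed
  then show ?thesis using b c eucl by blast
qed

lemma reachable_L_model:
  fixes V :: "'w \<Rightarrow> 'p \<Rightarrow> bool" and L :: cube
  assumes frame: "\<And>s. (\<And>\<alpha>::'p fm. scheme_inst s \<alpha> \<in> thms L) \<Longrightarrow> frame_cond s U R"
    and R_sub: "R \<subseteq> U \<times> U" and a: "a \<in> U" and \<Lambda>: "subformula_closed \<Lambda>"
  defines "val w \<equiv> restrict (world_val R V w) \<Lambda>"
  defines "S \<equiv> R\<^sup>* `` {a}"
  shows "L_model L \<Lambda> (val ` S) {(val w, val u) | w u. w \<in> S \<and> (w, u) \<in> R}" (is "L_model _ _ ?W ?R")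
proof -
  have frame': "frame_cond s U R" if "s \<in> schemes L" for s
    using that by (intro frame thms.scheme)
  have S_U: "w \<in> U" if "w \<in> S" for w
    using that R_sub a unfolding S_def by (auto elim: rtranclE)
  have S_step: "u \<in> S" if "w \<in> S" "(w, u) \<in> R" for w u
    using that unfolding S_def by auto
  have val_\<Lambda>: "val w \<beta> = world_val R V w \<beta>" if "\<beta> \<in> \<Lambda>" for w \<beta>
    using that by (simp add: val_def)
  \<comment> \<open>An edge of valuations comes with a pair of related worlds representing both
    ends, so a property of single edges transfers.\<close>
  have edge_cond: "P (v \<beta>) (v' \<beta>)"
    if "\<And>w u \<beta>. (w, u) \<in> R \<Longrightarrow> P (world_val R V w \<beta>) (world_val R V u \<beta>)"
      and "(v, v') \<in> ?R" and "\<beta> \<in> \<Lambda>" for P v v' \<beta>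
    using that by (auto simp: val_\<Lambda>)
  have pre: "pre_model L \<Lambda> ?W ?R"
    unfolding pre_model_def
  proof (intro conjI ballI)
    show "?W \<subseteq> partial_vals L \<Lambda>"
      using world_val_partial_vals[OF frame' R_sub S_U \<Lambda>] unfolding val_def by blast
    show "?R \<subseteq> ?W \<times> ?W" using S_step by blast
  next
    fix v \<beta> assume "v \<in> ?W" and \<beta>: "\<beta> \<in> \<Lambda>"
    then obtain w where w: "v = val w" "w \<in> S" by blast
    have succ: "\<exists>v'\<in>?W. (v, v') \<in> ?R \<and> P (v' \<beta>)"
      if "(w, u) \<in> R" "P (world_val R V u \<beta>)" for u P
      using that w \<beta> S_step by (intro bexI[of _ "val u"]) (auto simp: val_\<Lambda>)
    show "v \<beta> \<in> PP \<longrightarrow> (\<exists>w\<in>?W. (v, w) \<in> ?R \<and> w \<beta> \<in> Des)"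
      using w \<beta> succ[of _ "\<lambda>x. x \<in> Des"] by (auto simp: val_\<Lambda> world_val_def)
    show "v \<beta> \<in> PN \<longrightarrow> (\<exists>w\<in>?W. (v, w) \<in> ?R \<and> w \<beta> \<notin> Des)"
      using w \<beta> succ[of _ "\<lambda>x. x \<notin> Des"] by (auto simp: val_\<Lambda> world_val_def)
  qed
  have "K_model L \<Lambda> ?W ?R"
    unfolding K_model_def using pre by (auto simp: val_\<Lambda> world_val_def)
  moreover have "scheme_cond s \<Lambda> ?W ?R" if s: "\<And>\<alpha>::'p fm. scheme_inst s \<alpha> \<in> thms L" for s
  proof (cases s)
    case Ax_D
    then have "\<exists>u. (w, u) \<in> R" if "w \<in> S" for w using frame[OF s] S_U[OF that] by auto
    then show ?thesis using Ax_D by (fastforce simp: val_\<Lambda> world_val_def)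
  next
    case Ax_T
    then have "(w, w) \<in> R" if "w \<in> S" for w using frame[OF s] S_U[OF that] by auto
    then show ?thesis using Ax_T by (auto simp: val_\<Lambda> world_val_def)
  next
    case Ax_B
    have "(world_val R V w \<beta> \<in> Des \<longrightarrow> world_val R V u \<beta> \<in> PP) \<and>
        (world_val R V w \<beta> \<notin> Des \<longrightarrow> world_val R V u \<beta> \<in> PN)" if "(w, u) \<in> R" for w u \<beta>
      using symD[OF frame[OF s, unfolded Ax_B frame_cond.simps] that]
      by (auto simp: world_val_def)
    note edge_cond[where P = "\<lambda>x y. (x \<in> Des \<longrightarrow> y \<in> PP) \<and> (x \<notin> Des \<longrightarrow> y \<in> PN)", OF this]
    then show ?thesis unfolding Ax_B scheme_cond.simps by (intro ballI impI)
  next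
    case Ax_4
    have "(world_val R V w \<beta> \<in> NN \<longrightarrow> world_val R V u \<beta> \<in> NN) \<and>
        (world_val R V w \<beta> \<in> II \<longrightarrow> world_val R V u \<beta> \<in> II)" if "(w, u) \<in> R" for w u \<beta>
      using transD[OF frame[OF s, unfolded Ax_4 frame_cond.simps] that]
      by (auto simp: world_val_def)
    note edge_cond[where P = "\<lambda>x y. (x \<in> NN \<longrightarrow> y \<in> NN) \<and> (x \<in> II \<longrightarrow> y \<in> II)", OF this]
    then show ?thesis unfolding Ax_4 scheme_cond.simps by (intro ballI impI)
  next
    case Ax_5
    have eucl: "(u, u') \<in> R" if "(w, u) \<in> R" "(w, u') \<in> R" for w u u'
      using frame[OF s, unfolded Ax_5 frame_cond.simps] that by metis
    \<comment> \<open>Only the target of an edge is claimed to be properly reachable; the source may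
      be \<open>a\<close> itself, outside the cluster.\<close>
    have edge: "\<exists>u. v' = val u \<and> (a, u) \<in> R\<^sup>+" if "(v, v') \<in> ?R" for v v'
      using that unfolding S_def by (blast intro: rtrancl_into_trancl1)
    have uniform: "(c, d) \<in> R" if "(a, b) \<in> R\<^sup>+" "(a, c) \<in> R\<^sup>+" "(b, d) \<in> R" for b c d
      using euclidean_cluster[of R a c d] eucl trancl_into_trancl[OF that(1,3)] that(2) by metis
    have "(world_val R V w \<beta> \<in> PP \<longrightarrow> world_val R V u \<beta> \<in> PP) \<and>
        (world_val R V w \<beta> \<in> PN \<longrightarrow> world_val R V u \<beta> \<in> PN)" if "(w, u) \<in> R" for w u \<beta>
      using eucl[OF that] by (auto simp: world_val_def)
    note PP_PN = edge_cond[where P = "\<lambda>x y. (x \<in> PP \<longrightarrow> y \<in> PP) \<and> (x \<in> PN \<longrightarrow> y \<in> PN)", OF this]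
    have NN_II: "(v \<beta> \<in> NN \<and> v' \<beta> \<in> NN \<longrightarrow> v'' \<beta> \<in> NN) \<and> (v \<beta> \<in> II \<and> v' \<beta> \<in> II \<longrightarrow> v'' \<beta> \<in> II)"
      if E: "(v, v') \<in> ?R \<and> ((v, v'') \<in> ?R \<or> (v', v'') \<in> ?R)" and "\<beta> \<in> \<Lambda>" for v v' v'' \<beta>
    proof -
      \<comment> \<open>\<open>v'\<close> and \<open>v''\<close> are targets of edges, and their
        representatives are chosen independently. Both lie in the cluster, so every successor of
        \<open>u'\<close> is one of \<open>u\<close>, and the bits for \<open>NN\<close> and
        \<open>II\<close> pass from \<open>v'\<close> to \<open>v''\<close>.\<close>
      obtain u where u: "v' = val u" "(a, u) \<in> R\<^sup>+" using E edge by meson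
      obtain u' where u': "v'' = val u'" "(a, u') \<in> R\<^sup>+" using E edge by meson
      show ?thesis
        using uniform[OF u'(2) u(2)] that(2) by (auto simp: u(1) u'(1) val_\<Lambda> world_val_def)
    qed
    show ?thesis
      unfolding Ax_5 scheme_cond.simps
      by (rule conjI) (intro ballI impI PP_PN NN_II; assumption)+
  qed
  ultimately show ?thesis unfolding L_model_def by blast
qed

text \<open>Subformula closedness is stable under intersections, so the hull has it too.\<close>

lemma subformula_closed_closure: "subformula_closed (subformula_closure S)"
  unfolding subformula_closure_def by (rule hull_in) (auto simp: subformula_closed_def)

theorem theorem7:
  fixes L :: cube and \<Gamma> :: "'p fm set" and \<alpha> :: "'p fm"
  assumes "\<Gamma> \<Turnstile>\<^bsub>L\<^esub> \<alpha>"
  shows "\<Gamma> \<turnstile>\<^bsub>L\<^esub> \<alpha>"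
proof (rule ccontr)
  assume "\<not> \<Gamma> \<turnstile>\<^bsub>L\<^esub> \<alpha>"
  then have "\<^bold>\<bottom> \<notin> conseqs L (insert (\<^bold>\<not> \<alpha>) \<Gamma>)"
    using conseqs_imp_derives conseqs_contradiction by blast
  then obtain a where a: "MCS L a" "insert (\<^bold>\<not> \<alpha>) \<Gamma> \<subseteq> a"
    by (rule Lindenbaum)
  let ?\<Lambda> = "subformula_closure (\<Gamma> \<union> {\<alpha>})"
  let ?V = "\<lambda>w p. Atom p \<in> w"
  let ?v = "restrict (world_val (canonical_rel L) ?V a) ?\<Lambda>"
  have \<Lambda>: "\<Gamma> \<union> {\<alpha>} \<subseteq> ?\<Lambda>"
    unfolding subformula_closure_def by (rule hull_subset)
  have "canonical_rel L \<subseteq> {w::'p fm set. MCS L w} \<times> {w. MCS L w}"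
    by (auto simp: canonical_rel_def)
  \<comment> \<open>\<open>a\<close> reaches itself in zero steps, so its valuation belongs to the
    model generated from it.\<close>
  then have "?v \<in> partial_level_vals L ?\<Lambda>"
    using reachable_L_model[of L "{w. MCS L w}" "canonical_rel L" a ?\<Lambda> ?V,
        OF canonical_frame_cond _ _ subformula_closed_closure] a(1)
    unfolding partial_level_vals_def by blast
  moreover have Des: "?v \<beta> \<in> Des \<longleftrightarrow> \<beta> \<in> a" if "\<beta> \<in> \<Gamma> \<union> {\<alpha>}" for \<beta>
  proof -
    have "\<beta> \<in> ?\<Lambda>" using that \<Lambda> by blast
    then show ?thesis using canonical_truth[OF a(1)] by (simp add: world_val_def)
  qed
  ultimately have "\<alpha> \<in> a"
    using assms a(2) unfolding entails_def by blast
  then show False using a(2) MCS_MP[OF a(1)] MCS_Bot[OF a(1)] by blast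
qed

end
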